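(* Let $p>3$ be a prime and let $d\in\{0,1,\ldots,(p-1)/2\}$. Then $$\sum_{k=0}^{(p-1)/2}\frac{\binom{2k}k\binom{2k+2d}{k+d}}{16^k}\equiv 4^d\left(\frac{-1}p\right)\pmod{p^2},$$ and moreover $$\sum_{k=0}^{(p-1)/2}\frac{\binom{2k}k\binom{2k}{k+d}}{16^k}\equiv\left(\frac{-1}p\right)+p^2\frac{(-1)^d}4E_{p-3}\left(d+\frac12\right)\pmod{p^3}.$$
   Context: $\left(\frac{\cdot}{p}\right)$ is the Legendre symbol. $E_n(x)$ denotes the Euler polynomial of degree $n$, defined by $\frac{2e^{xt}}{e^t+1}=\sum_{n\ge0}E_n(x)\frac{t^n}{n!}$. For rational numbers $a,b$ whose denominators are not divisible by $p$, $a\equiv b\pmod{p^m}$ means $(a-b)/p^m$ has denominator not divisible by $p$. *)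

theory Defs
  imports
    "HOL-Number_Theory.Number_Theory"
    "HOL-Computational_Algebra.Computational_Algebra"
begin

definition euler_poly :: "nat \<Rightarrow> rat \<Rightarrow> rat" where
  "euler_poly n x = fact n * fps_nth (2 * fps_exp x / (fps_exp 1 + 1)) n"

lemma euler_poly_generating_function:
  "(fps_exp 1 + 1) * Abs_fps (\<lambda>n. euler_poly n x / fact n) = 2 * fps_exp x"
proof -
  have unit: "fps_nth (fps_exp (1::rat) + 1) 0 \<noteq> 0"
    by simp
  have "Abs_fps (\<lambda>n. euler_poly n x / fact n) = 2 * fps_exp x / (fps_exp 1 + 1)"
    by (rule fps_ext) (simp add: euler_poly_def)
  also have "\<dots> = 2 * fps_exp x * inverse (fps_exp 1 + 1)"
    by (rule fps_divide_unit[OF unit])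
  finally have "(fps_exp 1 + 1) * Abs_fps (\<lambda>n. euler_poly n x / fact n)
      = ((fps_exp 1 + 1) * inverse (fps_exp 1 + 1)) * (2 * fps_exp x)"
    by (simp only: mult_ac)
  also have "\<dots> = 2 * fps_exp x"
    by (simp only: inverse_mult_eq_1'[OF unit] mult_1_left)
  finally show ?thesis .
qed

definition p_integral :: "nat \<Rightarrow> rat \<Rightarrow> bool" where
  "p_integral p a \<longleftrightarrow> \<not> int p dvd snd (quotient_of a)"

text \<open>The congruence is only meaningful between \<open>p\<close>-integral rationals, so the relation
  includes this requirement on both sides.\<close>

definition rat_cong :: "nat \<Rightarrow> nat \<Rightarrow> rat \<Rightarrow> rat \<Rightarrow> bool" where
  "rat_cong p m a b \<longleftrightarrow>
     p_integral p a \<and> p_integral p b \<and> p_integral p ((a - b) / of_nat p ^ m)"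

end

theory Submission
  imports Defs
begin

text \<open>
  Write \<open>p = 2 n + 1\<close>, \<open>b\<^sub>k = (2k choose k) / 4^k\<close>, \<open>c\<^sub>k(d) = (2k choose (k + d)) / 4^k\<close> and
  \<open>S\<^sub>d = \<Sum>k\<le>n. b\<^sub>k c\<^sub>k(d)\<close>. Creative telescoping in \<open>k\<close> gives exact formulas for
  \<open>(2d + 3)(S\<^sub>d\<^sub>+\<^sub>2 - S\<^sub>d\<^sub>+\<^sub>1) - (2d + 1)(S\<^sub>d\<^sub>+\<^sub>1 - S\<^sub>d)\<close> and \<open>S\<^sub>1 - S\<^sub>0\<close>: both are boundary terms at \<open>k = n + 1\<close>,
  which carry a factor \<open>p^2\<close>. Hence \<open>S\<^sub>d\<^sub>+\<^sub>1 - S\<^sub>d \<equiv> -2 p^2 (-1)^d / (2d + 1)^2\<close> modulo \<open>p^3\<close>. By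
  \<open>E\<^sub>m(x + 1) + E\<^sub>m(x) = 2 x^m\<close> and Fermat's theorem the right-hand side of the claim has the same
  differences, so it suffices to compare both sides at \<open>d = n\<close>. There the sum collapses to
  \<open>(2n choose n) / 16^n\<close>, which is \<open>(-1)^n\<close> modulo \<open>p^3\<close> by Morley's congruence, while
  \<open>E\<^sub>p\<^sub>-\<^sub>3(n + 1/2) = E\<^sub>p\<^sub>-\<^sub>3(p/2) \<equiv> E\<^sub>p\<^sub>-\<^sub>3(0) = 0\<close> modulo \<open>p\<close>. The first congruence follows from its case
  \<open>d = 0\<close> by a telescoping formula for \<open>\<Sum>k\<le>n. b\<^sub>k (b\<^sub>k\<^sub>+\<^sub>d\<^sub>+\<^sub>1 - b\<^sub>k\<^sub>+\<^sub>d)\<close>.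
\<close>

section \<open>Congruences between rationals\<close>

text \<open>The reduced denominator divides the denominator of every other representation, so the
  closure rules below can be proved with unreduced fractions.\<close>

lemma p_integral_iff:
  assumes "prime p"
  shows "p_integral p a \<longleftrightarrow> (\<exists>x y. a = of_int x / of_int y \<and> \<not> int p dvd y)"
proof
  assume "p_integral p a"
  then show "\<exists>x y. a = of_int x / of_int y \<and> \<not> int p dvd y"
    unfolding p_integral_def
    by (intro exI[of _ "fst (quotient_of a)"] exI[of _ "snd (quotient_of a)"])
       (simp add: quotient_of_div)
next
  assume "\<exists>x y. a = of_int x / of_int y \<and> \<not> int p dvd y"
  then obtain x y where xy: "a = of_int x / of_int y" "\<not> int p dvd y" by blast
  obtain r s where rs: "quotient_of a = (r, s)" by fastforce
  have a: "a = of_int r / of_int s" and s: "s > 0" and cop: "coprime r s"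
    using rs by (auto simp: quotient_of_div quotient_of_denom_pos quotient_of_coprime)
  from xy have y: "y \<noteq> 0" by auto
  have "(of_int (r * y) :: rat) = of_int (x * s)"
    using a xy(1) s y by (simp add: field_simps)
  then have "r * y = x * s" by (simp only: of_int_eq_iff)
  then have "s dvd r * y" by simp
  then have "s dvd y" using cop by (simp add: coprime_commute coprime_dvd_mult_right_iff)
  then show "p_integral p a"
    unfolding p_integral_def rs using xy(2) by (auto intro: dvd_trans)
qed

context
  fixes p :: nat
  assumes prime_p: "prime p"
begin

lemma p_integral_of_int [simp]: "p_integral p (of_int x)"
  unfolding p_integral_iff[OF prime_p] using prime_p
  by (intro exI[of _ x] exI[of _ 1]) (auto dest: not_prime_unit)

lemma p_integral_of_nat [simp]: "p_integral p (of_nat x)"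
  using p_integral_of_int[of "int x"] by simp

lemma p_integral_numeral [simp]: "p_integral p (numeral x)"
  using p_integral_of_nat[of "numeral x"] by simp

lemma p_integral_0 [simp]: "p_integral p 0" and p_integral_1 [simp]: "p_integral p 1"
  using p_integral_of_nat[of 0] p_integral_of_nat[of 1] by simp_all

lemma p_integral_inverse [simp]:
  assumes "\<not> p dvd y"
  shows "p_integral p (inverse (of_nat y))"
  unfolding p_integral_iff[OF prime_p]
  by (rule exI[of _ 1], rule exI[of _ "int y"]) (use assms in \<open>simp add: inverse_eq_divide\<close>)

lemma p_integral_mult [simp]:
  assumes "p_integral p a" "p_integral p b"
  shows "p_integral p (a * b)"
proof -
  obtain x y x' y' where *: "a = of_int x / of_int y" "\<not> int p dvd y"
      "b = of_int x' / of_int y'" "\<not> int p dvd y'"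
    using assms unfolding p_integral_iff[OF prime_p] by blast
  then have "\<not> int p dvd y * y'"
    using prime_p by (simp add: prime_dvd_mult_iff)
  with * show ?thesis unfolding p_integral_iff[OF prime_p]
    by (intro exI[of _ "x * x'"] exI[of _ "y * y'"]) simp
qed

lemma p_integral_add [simp]:
  assumes "p_integral p a" "p_integral p b"
  shows "p_integral p (a + b)"
proof -
  obtain x y x' y' where *: "a = of_int x / of_int y" "\<not> int p dvd y"
      "b = of_int x' / of_int y'" "\<not> int p dvd y'"
    using assms unfolding p_integral_iff[OF prime_p] by blast
  then have "\<not> int p dvd y * y'"
    using prime_p by (simp add: prime_dvd_mult_iff)
  moreover have "y \<noteq> 0" "y' \<noteq> 0" using * by auto
  ultimately show ?thesis using * unfolding p_integral_iff[OF prime_p]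
    by (intro exI[of _ "x * y' + x' * y"] exI[of _ "y * y'"]) (simp add: field_simps)
qed

lemma p_integral_minus [simp]: "p_integral p a \<Longrightarrow> p_integral p (- a)"
  using p_integral_mult[OF p_integral_of_int[of "- 1"], of a] by simp

lemma p_integral_diff [simp]: "p_integral p a \<Longrightarrow> p_integral p b \<Longrightarrow> p_integral p (a - b)"
  using p_integral_add[of a "- b"] by simp

lemma p_integral_power [simp]: "p_integral p a \<Longrightarrow> p_integral p (a ^ k)"
  by (induction k) simp_all

lemma p_integral_sum: "(\<And>i. i \<in> A \<Longrightarrow> p_integral p (f i)) \<Longrightarrow> p_integral p (sum f A)"
  by (induction A rule: infinite_finite_induct) simp_all

lemma p_integral_divide:
  "p_integral p a \<Longrightarrow> \<not> p dvd y \<Longrightarrow> p_integral p (a / of_nat y)"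
  by (simp add: divide_inverse)

text \<open>Integrality of \<open>a\<close> is automatic once \<open>a\<close> is \<open>b\<close>
  plus an integral multiple of p^m; the explicit cofactor \<open>c\<close> is what products and
  rescaling work with.\<close>

lemma rat_cong_iff:
  "rat_cong p m a b \<longleftrightarrow> p_integral p b \<and> (\<exists>c. p_integral p c \<and> a = b + of_nat p ^ m * c)"
proof -
  have nz: "(of_nat p ^ m :: rat) \<noteq> 0" using prime_p by (auto simp: prime_gt_0_nat)
  show ?thesis
  proof
    assume "rat_cong p m a b"
    then show "p_integral p b \<and> (\<exists>c. p_integral p c \<and> a = b + of_nat p ^ m * c)"
      unfolding rat_cong_def using nz
      by (intro conjI exI[of _ "(a - b) / of_nat p ^ m"]) auto
  next
    assume "p_integral p b \<and> (\<exists>c. p_integral p c \<and> a = b + of_nat p ^ m * c)"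
    then show "rat_cong p m a b" unfolding rat_cong_def using nz by auto
  qed
qed

lemma rat_cong_refl [simp]: "rat_cong p m a a \<longleftrightarrow> p_integral p a"
  by (simp add: rat_cong_def)

lemma rat_cong_integral: "rat_cong p m a b \<Longrightarrow> p_integral p a" "rat_cong p m a b \<Longrightarrow> p_integral p b"
  by (simp_all add: rat_cong_def)

lemma rat_cong_add:
  assumes "rat_cong p m a b" "rat_cong p m a' b'"
  shows "rat_cong p m (a + a') (b + b')"
  using assms p_integral_add[of "(a - b) / of_nat p ^ m" "(a' - b') / of_nat p ^ m"]
  unfolding rat_cong_def by (simp add: diff_divide_distrib add_divide_distrib algebra_simps)

lemma rat_cong_mult:
  assumes "rat_cong p m a b" "rat_cong p m a' b'"
  shows "rat_cong p m (a * a') (b * b')"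
proof -
  obtain c c' where c: "p_integral p c" "a = b + of_nat p ^ m * c"
      "p_integral p c'" "a' = b' + of_nat p ^ m * c'"
    using assms unfolding rat_cong_iff by blast
  have "p_integral p b" "p_integral p b'" using assms rat_cong_integral by blast+
  with c show ?thesis unfolding rat_cong_iff
    by (intro conjI exI[of _ "c * b' + b * c' + of_nat p ^ m * c * c'"])
       (simp_all add: algebra_simps)
qed

lemma rat_cong_minus: "rat_cong p m a b \<Longrightarrow> rat_cong p m (- a) (- b)"
  using rat_cong_mult[of m "-1" "-1" a b] by simp

lemma rat_cong_diff:
  "rat_cong p m a b \<Longrightarrow> rat_cong p m a' b' \<Longrightarrow> rat_cong p m (a - a') (b - b')"
  using rat_cong_add[of m a b "- a'" "- b'"] rat_cong_minus by simp

text \<open>Add the two congruences, then subtract \<open>b\<close> from both sides.\<close>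

lemma rat_cong_trans [trans]:
  "rat_cong p m a b \<Longrightarrow> rat_cong p m b c \<Longrightarrow> rat_cong p m a c"
  using rat_cong_add[of m a b b c] rat_cong_diff[of m "a + b" "b + c" b b] rat_cong_integral[of m b c]
  by simp

lemma rat_cong_sym: "rat_cong p m a b \<Longrightarrow> rat_cong p m b a"
  using rat_cong_diff[of m "a + b" "a + b" a b] rat_cong_integral[of m a b] by simp

lemma rat_cong_power: "rat_cong p m a b \<Longrightarrow> rat_cong p m (a ^ k) (b ^ k)"
  by (induction k) (simp_all add: rat_cong_mult)

lemma rat_cong_sum:
  "(\<And>i. i \<in> A \<Longrightarrow> rat_cong p m (f i) (g i)) \<Longrightarrow> rat_cong p m (sum f A) (sum g A)"
  by (induction A rule: infinite_finite_induct) (simp_all add: rat_cong_add)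

text \<open>An explicit power of p raises the modulus. The corrections below are p or p^2 times a
  number that need only be known modulo p.\<close>

lemma rat_cong_scale:
  assumes "rat_cong p m a b"
  shows "rat_cong p (k + m) (of_nat p ^ k * a) (of_nat p ^ k * b)"
proof -
  obtain c where c: "p_integral p b" "p_integral p c" "a = b + of_nat p ^ m * c"
    using assms unfolding rat_cong_iff by blast
  then show ?thesis unfolding rat_cong_iff
    by (intro conjI exI[of _ c]) (simp_all add: algebra_simps power_add)
qed

lemma rat_cong_mono:
  assumes "rat_cong p m a b" "k \<le> m"
  shows "rat_cong p k a b"
proof -
  obtain c where c: "p_integral p b" "p_integral p c" "a = b + of_nat p ^ m * c"
    using assms unfolding rat_cong_iff by blast
  moreover have "of_nat p ^ m = (of_nat p ^ k * of_nat p ^ (m - k) :: rat)"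
    using assms(2) by (simp flip: power_add)
  ultimately show ?thesis unfolding rat_cong_iff
    by (intro conjI exI[of _ "of_nat p ^ (m - k) * c"]) simp_all
qed

lemma rat_cong_divide:
  assumes "rat_cong p m a b" "\<not> p dvd y"
  shows "rat_cong p m (a / of_nat y) (b / of_nat y)"
  using rat_cong_mult[OF assms(1), of "inverse (of_nat y)" "inverse (of_nat y)"] assms(2)
  by (simp add: divide_inverse)

lemma rat_cong_cancel:
  assumes "rat_cong p m (of_nat y * a) (of_nat y * b)" "\<not> p dvd y"
  shows "rat_cong p m a b"
proof -
  have "(of_nat y :: rat) \<noteq> 0" using assms(2) by (metis dvd_0_right of_nat_eq_0_iff)
  then show ?thesis using rat_cong_divide[OF assms] by simp
qed

lemma rat_cong_0_of_nat: "p dvd y \<Longrightarrow> rat_cong p 1 (of_nat y) 0"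
  unfolding rat_cong_iff by (auto elim!: dvdE) (metis p_integral_of_nat)

lemma rat_cong_of_int:
  assumes "[x = y] (mod int p)"
  shows "rat_cong p 1 (of_int x) (of_int y)"
proof -
  obtain z where "x = y + int p * z"
    using assms by (metis cong_iff_lin cong_sym)
  then show ?thesis unfolding rat_cong_iff by (auto intro!: exI[of _ "of_int z"])
qed

section \<open>Fermat's theorem and row p - 1 of Pascal's triangle\<close>

lemma rat_cong_fermat:
  assumes "\<not> p dvd y"
  shows "rat_cong p 1 (of_nat y ^ (p - 1)) 1"
proof -
  have "[int (y ^ (p - 1)) = int 1] (mod int p)"
    using fermat_theorem[OF prime_p assms] by (simp only: cong_int_iff)
  from rat_cong_of_int[OF this] show ?thesis by simp
qed

text \<open>Neighbours in row p - 1 add up to an inner entry of row p, which p divides; hence the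
  signs alternate.\<close>

lemma rat_cong_choose_prime_minus_1:
  assumes "k \<le> p - 1"
  shows "rat_cong p 1 (of_nat ((p - 1) choose k)) ((- 1) ^ k)"
  using assms
proof (induction k)
  case 0
  then show ?case by simp
next
  case (Suc k)
  have p1: "Suc (p - 1) = p" using prime_p by (simp add: prime_gt_0_nat)
  have "p dvd (p choose Suc k)"
    using Suc.prems p1 prime_p by (intro dvd_choose_prime) auto
  then have "rat_cong p 1 (of_nat (p choose Suc k)) 0" by (rule rat_cong_0_of_nat)
  moreover have "p choose Suc k = ((p - 1) choose k) + ((p - 1) choose Suc k)"
    using binomial_Suc_Suc[of "p - 1" k] p1 by simp
  ultimately have "rat_cong p 1 (of_nat ((p - 1) choose k) + of_nat ((p - 1) choose Suc k)) 0"
    by simp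
  from rat_cong_diff[OF this Suc.IH] Suc.prems show ?case by simp
qed

end

section \<open>Splitting an interval of even length\<close>

text \<open>For p = 2n + 1 this pairs k with p - k. The monoid setting serves both the sums of
  inverse squares and the product (2n)!.\<close>

lemma (in comm_monoid_set) atLeastAtMost_double_fold:
  fixes n :: nat
  shows "F g {1..2 * n} = F (\<lambda>k. g k \<^bold>* g (2 * n + 1 - k)) {1..n}"
proof -
  have img: "(\<lambda>k. 2 * n + 1 - k) ` {1..n} = {n + 1..2 * n}"
  proof
    show "{n + 1..2 * n} \<subseteq> (\<lambda>k. 2 * n + 1 - k) ` {1..n}"
    proof
      fix i assume "i \<in> {n + 1..2 * n}"
      then show "i \<in> (\<lambda>k. 2 * n + 1 - k) ` {1..n}"
        by (intro rev_image_eqI[of "2 * n + 1 - i"]) auto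
    qed
  qed auto
  have "F g {1..2 * n} = F g ({1..n} \<union> {n + 1..2 * n})"
    by (rule arg_cong[of _ _ "F g"]) auto
  also have "\<dots> = F g {1..n} \<^bold>* F g {n + 1..2 * n}"
    by (rule union_disjoint) auto
  also have "F g {n + 1..2 * n} = F (\<lambda>k. g (2 * n + 1 - k)) {1..n}"
    unfolding img[symmetric] by (subst reindex) (auto simp: inj_on_def o_def)
  finally show ?thesis by (simp add: distrib)
qed

text \<open>Each even number 2k is paired with the odd number 2n + 1 - 2k.\<close>

lemma (in comm_monoid_set) atLeastAtMost_double_parity:
  fixes n :: nat
  shows "F g {1..2 * n} = F (\<lambda>k. g (2 * k) \<^bold>* g (2 * n + 1 - 2 * k)) {1..n}"
proof -
  have split: "{1..2 * n} = (\<lambda>k. 2 * k) ` {1..n} \<union> (\<lambda>k. 2 * n + 1 - 2 * k) ` {1..n}"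
  proof
    show "{1..2 * n} \<subseteq> (\<lambda>k. 2 * k) ` {1..n} \<union> (\<lambda>k. 2 * n + 1 - 2 * k) ` {1..n}"
    proof
      fix i assume i: "i \<in> {1..2 * n}"
      show "i \<in> (\<lambda>k. 2 * k) ` {1..n} \<union> (\<lambda>k. 2 * n + 1 - 2 * k) ` {1..n}"
      proof (cases "even i")
        case True
        with i show ?thesis by (auto elim!: evenE)
      next
        case False
        then obtain j where "i = 2 * j + 1" by (auto elim: oddE)
        \<comment> \<open>The odd number 2j + 1 equals 2n + 1 - 2(n - j).\<close>
        with i show ?thesis by (intro UnI2 rev_image_eqI[of "n - j"]) auto
      qed
    qed
  qed auto
  have disj: "(\<lambda>k. 2 * k) ` {1..n} \<inter> (\<lambda>k. 2 * n + 1 - 2 * k) ` {1..n} = {}"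
  proof -
    have False if "2 * k = 2 * n + 1 - 2 * j" "j \<le> n" for j k :: nat
      using that by presburger
    then show ?thesis by auto
  qed
  have inj: "inj_on (\<lambda>k. 2 * n + 1 - 2 * k) {1..n}"
    by (rule inj_onI) (simp, arith)
  have inj2: "inj_on (\<lambda>k. 2 * k) {1..n}"
    by (rule inj_onI) simp
  show ?thesis
    unfolding split
    by (subst union_disjoint[OF _ _ disj])
       (simp_all only: finite_imageI finite_atLeastAtMost reindex[OF inj] reindex[OF inj2] o_def distrib)
qed

section \<open>Telescoping identities\<close>

text \<open>This is (-1)^k (-1/2 choose k). Writing 16^k as 4^k 4^k gives each binomial coefficient
  its own normalisation.\<close>

definition central_quot :: "nat \<Rightarrow> rat" where
  "central_quot k = of_nat ((2 * k) choose k) / 4 ^ k"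

definition offset_quot :: "nat \<Rightarrow> nat \<Rightarrow> rat" where
  "offset_quot k d = of_nat ((2 * k) choose (k + d)) / 4 ^ k"

lemma offset_quot_0 [simp]: "offset_quot k 0 = central_quot k"
  by (simp add: central_quot_def offset_quot_def)

text \<open>The ratio of neighbours in row 2k, kept free of division so that it also covers d \<ge>
  k.\<close>

lemma offset_quot_Suc_right: "(of_nat k + of_nat d + 1) * offset_quot k (Suc d) = (of_nat k - of_nat d) * offset_quot k d"
proof -
  have "of_nat (2 * k) * (of_nat (2 * k) gchoose (k + d)) =
      of_nat (k + d) * ((of_nat (2 * k) :: rat) gchoose (k + d))
      + of_nat (Suc (k + d)) * (of_nat (2 * k) gchoose Suc (k + d))"
    by (rule gbinomial_mult_1)
  then show ?thesis
    unfolding offset_quot_def binomial_gbinomial by (simp add: field_simps)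
qed

text \<open>Pascal's rule applied twice leads from row 2k + 2 to row 2k; the 4 compensates for the
  change of normalisation.\<close>

lemma offset_quot_Suc_left: "4 * offset_quot (Suc k) (Suc d) = offset_quot k d + 2 * offset_quot k (Suc d) + offset_quot k (Suc (Suc d))"
proof -
  have "(2 * Suc k) choose (Suc k + Suc d) =
      ((2 * k) choose (k + d)) + 2 * ((2 * k) choose (k + Suc d)) + ((2 * k) choose (k + Suc (Suc d)))"
    by simp
  then have "(of_nat ((2 * Suc k) choose (Suc k + Suc d)) :: rat) =
      of_nat ((2 * k) choose (k + d)) + 2 * of_nat ((2 * k) choose (k + Suc d))
      + of_nat ((2 * k) choose (k + Suc (Suc d)))"
    by simp
  then show ?thesis unfolding offset_quot_def by (simp add: field_simps)
qed

lemma central_quot_Suc: "2 * (of_nat k + 1) * central_quot (Suc k) = (2 * of_nat k + 1) * central_quot k"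
proof -
  have "4 * central_quot (Suc k) = 2 * central_quot k + 2 * offset_quot k 1" if "k > 0"
  proof -
    have "(2 * Suc k) choose Suc k
        = ((2 * k) choose k) + ((2 * k) choose Suc k) + ((2 * k) choose (k - 1)) + ((2 * k) choose k)"
      using that by (cases k) simp_all
    moreover have "(2 * k) choose (k - 1) = ((2 * k) choose Suc k)"
      using binomial_symmetric[of "k - 1" "2 * k"] that by (simp add: Suc_diff_Suc mult_2)
    ultimately show ?thesis unfolding central_quot_def offset_quot_def by (simp add: field_simps)
  qed
  moreover have "4 * central_quot (Suc k) = 2 * central_quot k + 2 * offset_quot k 1" if "k = 0"
    using that unfolding central_quot_def offset_quot_def by (simp add: numeral_2_eq_2)
  \<comment> \<open>The two outer neighbours of the central entry are equal by symmetry. The case k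
    = 0 is separate because \<open>k - 1\<close> truncates there.\<close>
  ultimately have *: "4 * central_quot (Suc k) = 2 * central_quot k + 2 * offset_quot k 1" by blast
  have **: "(of_nat k + 1) * offset_quot k 1 = of_nat k * central_quot k" using offset_quot_Suc_right[of k 0] by simp
  have "2 * (2 * (of_nat k + 1) * central_quot (Suc k)) = (of_nat k + 1) * (4 * central_quot (Suc k))" by simp
  also have "\<dots> = 2 * (of_nat k + 1) * central_quot k + 2 * ((of_nat k + 1) * offset_quot k 1)"
    unfolding * by (simp add: algebra_simps)
  also have "\<dots> = 2 * ((2 * of_nat k + 1) * central_quot k)"
    unfolding ** by (simp add: algebra_simps)
  finally show ?thesis by simp
qed

lemma offset_quot_Suc_left_closed:
  "4 * ((of_nat k + 1)\<^sup>2 - (of_nat d)\<^sup>2) * offset_quot (Suc k) d = (2 * of_nat k + 1) * (2 * of_nat k + 2) * offset_quot k d"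
proof (cases d)
  case 0
  have "(2 * of_nat k + 2) * (2 * (of_nat k + 1) * central_quot (Suc k)) = (2 * of_nat k + 2) * ((2 * of_nat k + 1) * central_quot k)"
    by (simp only: central_quot_Suc)
  then show ?thesis using 0 by (simp add: power2_eq_square algebra_simps)
next
  case (Suc e)
  define K E x y z where defs: "K = (of_nat k :: rat)" "E = (of_nat e :: rat)"
    "x = offset_quot k e" "y = offset_quot k (Suc e)" "z = offset_quot k (Suc (Suc e))"
  have 1: "4 * offset_quot (Suc k) d = x + 2 * y + z" and 2: "(K + E + 1) * y = (K - E) * x"
    and 3: "(K + E + 2) * z = (K - E - 1) * y"
    using offset_quot_Suc_left[of k e] offset_quot_Suc_right[of k e] offset_quot_Suc_right[of k "Suc e"]
    by (simp_all add: defs Suc algebra_simps)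
  \<comment> \<open>The difference of squares factors as (K - E)(K + E + 2), and these are the
    factors that turn x and z into multiples of y.\<close>
  have "4 * ((K + 1)\<^sup>2 - (E + 1)\<^sup>2) * offset_quot (Suc k) d = (K - E) * (K + E + 2) * (4 * offset_quot (Suc k) d)"
    by (simp add: algebra_simps power2_eq_square)
  also have "\<dots> = (K + E + 2) * ((K - E) * x) + 2 * (K - E) * (K + E + 2) * y + (K - E) * ((K + E + 2) * z)"
    unfolding 1 by (simp add: algebra_simps)
  also have "\<dots> = (2 * K + 1) * (2 * K + 2) * y"
    unfolding 2[symmetric] 3 by (simp add: algebra_simps)
  finally show ?thesis by (simp add: defs Suc add.commute)
qed

section \<open>Sums over k and their recurrences in d\<close>

text \<open>The sum S_d is the case \<open>N = Suc n\<close>. A free strict bound allows induction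
  on N and puts the boundary terms at index N.\<close>

definition quot_sum :: "nat \<Rightarrow> nat \<Rightarrow> rat" where
  "quot_sum N d = (\<Sum>k<N. central_quot k * offset_quot k d)"

text \<open>The same combination of the k-th summands is the forward difference in k of 8(d + 1) b_k
  c_k(d + 1), which vanishes at k = 0.\<close>

lemma quot_sum_recurrence:
  "(2 * of_nat d + 3) * (quot_sum N (d + 2) - quot_sum N (d + 1)) - (2 * of_nat d + 1) * (quot_sum N (d + 1) - quot_sum N d)
    = 8 * (of_nat d + 1) * central_quot N * offset_quot N (d + 1)"
  unfolding quot_sum_def
proof (induction N)
  case 0
  then show ?case by (simp add: offset_quot_def)
next
  case (Suc N)
  have nz: "of_nat N + 1 \<noteq> (0 :: rat)" by (metis of_nat_Suc add.commute of_nat_neq_0)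
  define K E x y z where defs: "K = (of_nat N :: rat)" "E = (of_nat d :: rat)"
    "x = offset_quot N d" "y = offset_quot N (Suc d)" "z = offset_quot N (Suc (Suc d))"
  have 1: "4 * offset_quot (Suc N) (Suc d) = x + 2 * y + z" and 2: "(K + E + 1) * y = (K - E) * x"
    and 3: "(K + E + 2) * z = (K - E - 1) * y" and 4: "2 * (K + 1) * central_quot (Suc N) = (2 * K + 1) * central_quot N"
    using offset_quot_Suc_left[of N d] offset_quot_Suc_right[of N d] offset_quot_Suc_right[of N "Suc d"] central_quot_Suc[of N]
    by (simp_all add: defs algebra_simps)
  \<comment> \<open>The factor 2(K + 1) clears the denominator of b_(N+1) / b_N.\<close>
  have "2 * (K + 1) * (8 * (E + 1) * (central_quot (Suc N) * offset_quot (Suc N) (Suc d) - central_quot N * y))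
      = 2 * (E + 1) * (2 * (K + 1) * central_quot (Suc N)) * (4 * offset_quot (Suc N) (Suc d)) - 16 * (K + 1) * (E + 1) * central_quot N * y"
    by (simp add: algebra_simps)
  also have "\<dots> = 2 * (E + 1) * (2 * K + 1) * central_quot N * (x + 2 * y + z) - 16 * (K + 1) * (E + 1) * central_quot N * y"
    unfolding 1 4 by (simp add: algebra_simps)
  \<comment> \<open>The subtracted bracket is zero by relations \<open>2\<close> and
    \<open>3\<close>.\<close>
  also have "\<dots> = 2 * (K + 1) * (central_quot N * ((2 * E + 3) * (z - y) - (2 * E + 1) * (y - x)))
      - 2 * central_quot N * ((K + E + 2) * z - (K - E) * x - (2 * E + 2) * y + (2 * E + 2) * y - ((K - E - 1) * y - (K + E + 1) * y))"
    by (simp add: algebra_simps)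
  also have "\<dots> = 2 * (K + 1) * (central_quot N * ((2 * E + 3) * (z - y) - (2 * E + 1) * (y - x)))"
    unfolding 2[symmetric] 3 by (simp add: algebra_simps)
  finally have "2 * (of_nat N + 1) * (central_quot N * ((2 * of_nat d + 3) * (offset_quot N (d + 2) - offset_quot N (d + 1)) - (2 * of_nat d + 1) * (offset_quot N (d + 1) - offset_quot N d)))
     = 2 * (of_nat N + 1) * (8 * (of_nat d + 1) * (central_quot (Suc N) * offset_quot (Suc N) (d + 1) - central_quot N * offset_quot N (d + 1)))"
    by (simp add: defs)
  then have "central_quot N * ((2 * of_nat d + 3) * (offset_quot N (d + 2) - offset_quot N (d + 1)) - (2 * of_nat d + 1) * (offset_quot N (d + 1) - offset_quot N d))
     = 8 * (of_nat d + 1) * (central_quot (Suc N) * offset_quot (Suc N) (d + 1) - central_quot N * offset_quot N (d + 1))"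
    using nz by simp
  then show ?case using Suc.IH unfolding sum.lessThan_Suc by (simp add: algebra_simps)
qed

text \<open>The recurrence only links consecutive differences; this supplies the first one, with
  antidifference -4k b_k^2.\<close>

lemma quot_sum_initial:
  "quot_sum N 1 - quot_sum N 0 = - 4 * of_nat N * central_quot N ^ 2"
  unfolding quot_sum_def
proof (induction N)
  case 0
  then show ?case by simp
next
  case (Suc N)
  have nz: "of_nat N + 1 \<noteq> (0 :: rat)" by (metis of_nat_Suc add.commute of_nat_neq_0)
  have 1: "central_quot (Suc N) = (2 * of_nat N + 1) * central_quot N / (2 * (of_nat N + 1))"
    using central_quot_Suc[of N] nz by (simp add: field_simps)
  have 2: "offset_quot N 1 = of_nat N * central_quot N / (of_nat N + 1)"
    using offset_quot_Suc_right[of N 0] nz by (simp add: field_simps)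
  have "central_quot N * offset_quot N 1 - central_quot N * offset_quot N 0 = - 4 * of_nat (Suc N) * central_quot (Suc N) ^ 2 + 4 * of_nat N * central_quot N ^ 2"
    unfolding 1 2 using nz by (simp add: divide_simps power2_eq_square) (simp add: algebra_simps)
  then show ?case using Suc.IH unfolding sum.lessThan_Suc by (simp add: algebra_simps)
qed

text \<open>Here the antidifference in k is -2k b_k b_(k+d).\<close>

lemma sum_central_quot_recurrence:
  "(2 * of_nat d + 1) * ((\<Sum>k<N. central_quot k * central_quot (k + Suc d)) - (\<Sum>k<N. central_quot k * central_quot (k + d)))
    = - 2 * of_nat N * central_quot N * central_quot (N + d)"
proof (induction N)
  case 0
  then show ?case by simp
next
  case (Suc N)
  have nz: "of_nat N + 1 \<noteq> (0 :: rat)" by (metis of_nat_Suc add.commute of_nat_neq_0)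
  have nz': "of_nat N + of_nat d + 1 \<noteq> (0 :: rat)" by (metis of_nat_Suc of_nat_add add.commute of_nat_neq_0)
  have 1: "central_quot (Suc N) = (2 * of_nat N + 1) * central_quot N / (2 * (of_nat N + 1))"
    using central_quot_Suc[of N] nz by (simp add: field_simps)
  have 2: "central_quot (Suc (N + d)) = (2 * (of_nat N + of_nat d) + 1) * central_quot (N + d) / (2 * (of_nat N + of_nat d + 1))"
    using central_quot_Suc[of "N + d"] nz' by (simp add: field_simps)
  have "(2 * of_nat d + 1) * (central_quot N * central_quot (Suc (N + d)) - central_quot N * central_quot (N + d))
    = - 2 * of_nat (Suc N) * central_quot (Suc N) * central_quot (Suc (N + d)) + 2 * of_nat N * central_quot N * central_quot (N + d)"
    unfolding 1 2 using nz nz' by (simp add: divide_simps) (simp add: algebra_simps)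
  then show ?case using Suc.IH unfolding sum.lessThan_Suc by (simp add: algebra_simps)
qed

section \<open>Euler polynomials\<close>

lemma fps_nth_double: "fps_nth (2 * f) n = 2 * fps_nth (f :: 'a :: comm_ring_1 fps) n"
  by (simp only: mult_2 fps_add_nth)

text \<open>Comparing coefficients in the generating function: the factor e^t produces the binomial
  convolution, the summand 1 the isolated term.\<close>

lemma euler_poly_sum:
  "(\<Sum>i\<le>n. of_nat (n choose i) * euler_poly i x) + euler_poly n x = 2 * x ^ n"
proof -
  have "fps_nth (Abs_fps (\<lambda>n. euler_poly n x / fact n) * (fps_exp 1 + 1)) n = fps_nth (2 * fps_exp x) n"
    using euler_poly_generating_function[of x] by (simp add: mult.commute)
  then have "(\<Sum>i\<le>n. euler_poly i x / fact i / fact (n - i)) + euler_poly n x / fact n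
      = 2 * x ^ n / fact n"
    unfolding fps_nth_double by (simp add: distrib_left fps_mult_nth atMost_atLeast0)
  then have "fact n * (\<Sum>i\<le>n. euler_poly i x / fact i / fact (n - i)) + euler_poly n x = 2 * x ^ n"
    by (simp add: field_simps)
  moreover have "fact n * (\<Sum>i\<le>n. euler_poly i x / fact i / fact (n - i))
     = (\<Sum>i\<le>n. of_nat (n choose i) * euler_poly i x)"
    by (simp add: sum_distrib_left binomial_fact field_simps)
  ultimately show ?thesis by simp
qed

text \<open>Solved for the top term, the recursion divides only by 2, which preserves congruences
  modulo an odd prime.\<close>

lemma euler_poly_rec:
  "euler_poly n x = x ^ n - (\<Sum>i<n. of_nat (n choose i) * euler_poly i x) / 2"
  using euler_poly_sum[of n x] by (simp add: lessThan_Suc_atMost[symmetric])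

text \<open>The numerators add up to 2 e^(xt) (e^t + 1), which cancels the denominator.\<close>

lemma euler_poly_plus_1: "euler_poly n (x + 1) + euler_poly n x = 2 * x ^ n"
proof -
  have unit: "fps_nth (fps_exp (1::rat) + 1) 0 \<noteq> 0" by simp
  have "2 * fps_exp (x + 1) / (fps_exp 1 + 1) + 2 * fps_exp x / (fps_exp 1 + 1)
     = 2 * fps_exp x * ((fps_exp 1 + 1) * inverse (fps_exp 1 + 1 :: rat fps))"
    unfolding fps_divide_unit[OF unit] fps_exp_add_mult by (simp add: algebra_simps)
  also have "\<dots> = 2 * fps_exp x"
    by (simp only: inverse_mult_eq_1'[OF unit] mult_1_right)
  finally have "fps_nth (2 * fps_exp (x + 1) / (fps_exp 1 + 1)) n
      + fps_nth (2 * fps_exp x / (fps_exp 1 + 1)) n = fps_nth (2 * fps_exp x) n"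
    by (metis fps_add_nth)
  then show ?thesis
    unfolding euler_poly_def fps_nth_double distrib_left[symmetric] by simp
qed

text \<open>Substitute -t for t in the generating function (composition with \<open>?m\<close>),
  then multiply by e^t to restore the factor e^t + 1.\<close>

lemma euler_poly_reflect: "euler_poly n (1 - x) = (- 1) ^ n * euler_poly n x"
proof -
  let ?A = "\<lambda>x. Abs_fps (\<lambda>n. euler_poly n x / fact n)"
  let ?m = "fps_const (- 1) * fps_X :: rat fps"
  have "((fps_exp 1 + 1) * ?A x) oo ?m = (2 * fps_exp x) oo ?m"
    by (simp only: euler_poly_generating_function)
  then have "(fps_exp (- 1) + 1) * (?A x oo ?m) = 2 * fps_exp (- x)"
    by (simp add: fps_compose_mult_distrib fps_compose_add_distrib)
  then have "fps_exp 1 * ((fps_exp (- 1) + 1) * (?A x oo ?m)) = fps_exp 1 * (2 * fps_exp (- x))"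
    by simp
  moreover have "fps_exp 1 * (fps_exp (- 1) + 1) = (fps_exp 1 + 1 :: rat fps)"
    by (simp add: distrib_left flip: fps_exp_add_mult)
  moreover have "fps_exp 1 * (2 * fps_exp (- x)) = 2 * (fps_exp (1 - x) :: rat fps)"
    using fps_exp_add_mult[of 1 "- x"] by (simp add: mult_ac)
  ultimately have "(fps_exp 1 + 1) * (?A x oo ?m) = (fps_exp 1 + 1) * ?A (1 - x)"
    unfolding euler_poly_generating_function by (metis mult.assoc)
  moreover have "fps_exp 1 + 1 \<noteq> (0 :: rat fps)"
  proof
    assume "fps_exp 1 + 1 = (0 :: rat fps)"
    then have "fps_nth (fps_exp 1 + 1) 0 = (fps_nth 0 0 :: rat)" by simp
    then show False by simp
  qed
  ultimately have "?A x oo ?m = ?A (1 - x)" by simp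
  then have "fps_nth (?A x oo ?m) n = fps_nth (?A (1 - x)) n" by simp
  then show ?thesis by (simp add: fps_compose_linear)
qed

text \<open>The values at 0 and 1 are equal by reflection and sum to 2 * 0^n = 0.\<close>

lemma euler_poly_even_0:
  assumes "even n" "n > 0"
  shows "euler_poly n 0 = 0"
  using euler_poly_plus_1[of n 0] euler_poly_reflect[of n 0] assms by simp

section \<open>Congruences modulo powers of the prime\<close>

context
  fixes p n :: nat
  assumes prime_p: "prime p" and p_gt_3: "p > 3" and p_eq: "p = 2 * n + 1"
begin

lemmas integral_simps [simp] =
  p_integral_of_int[OF prime_p] p_integral_of_nat[OF prime_p] p_integral_numeral[OF prime_p]
  p_integral_0[OF prime_p] p_integral_1[OF prime_p] p_integral_inverse[OF prime_p]
  p_integral_mult[OF prime_p] p_integral_add[OF prime_p] p_integral_minus[OF prime_p]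
  p_integral_diff[OF prime_p] p_integral_power[OF prime_p] rat_cong_refl[OF prime_p]

lemmas p_cong_add = rat_cong_add[OF prime_p]
lemmas p_cong_diff = rat_cong_diff[OF prime_p]
lemmas p_cong_mult = rat_cong_mult[OF prime_p]
lemmas p_cong_trans [trans] = rat_cong_trans[OF prime_p]
lemmas p_cong_integral = rat_cong_integral[OF prime_p]

lemma not_dvd_small: "0 < y \<Longrightarrow> y < p \<Longrightarrow> \<not> p dvd y"
  by (rule nat_dvd_not_less)

lemma half_range: "k \<in> {1..n} \<Longrightarrow> 0 < k \<and> k < p \<and> 0 < 2 * k \<and> 2 * k < p"
  using p_eq by auto

lemma not_dvd_4: "\<not> p dvd 4"
  using not_dvd_small[of 2] p_gt_3 prime_dvd_power[OF prime_p, of 2 2] by auto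

lemma rat_cong_p: "rat_cong p 1 (of_nat p) 0"
  by (rule rat_cong_0_of_nat[OF prime_p]) simp

text \<open>Multiply y \<equiv> x by the integral number 1/(xy).\<close>

lemma rat_cong_inverse:
  assumes "rat_cong p m (of_nat x) (of_nat y)" "\<not> p dvd x" "\<not> p dvd y"
  shows "rat_cong p m (1 / of_nat x) (1 / of_nat y)"
proof -
  have nz: "(of_nat x :: rat) \<noteq> 0" "(of_nat y :: rat) \<noteq> 0"
    using assms(2,3) by (metis dvd_0_right of_nat_eq_0_iff)+
  have "rat_cong p m (of_nat y * (inverse (of_nat x) * inverse (of_nat y)))
      (of_nat x * (inverse (of_nat x) * inverse (of_nat y)))"
    by (rule p_cong_mult[OF rat_cong_sym[OF prime_p assms(1)]]) (use assms(2,3) in simp)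
  then show ?thesis using nz by (simp add: field_simps)
qed

section \<open>Inverse squares modulo p\<close>

lemma rat_cong_inverse_square_reflect:
  assumes "0 < i" "i < p"
  shows "rat_cong p 1 (1 / of_nat (p - i) ^ 2) (1 / of_nat i ^ 2)"
proof -
  have "rat_cong p 1 (of_nat ((p - i)\<^sup>2)) (of_nat (i\<^sup>2))"
  proof -
    have "rat_cong p 1 (of_nat p * (of_nat p - 2 * of_nat i) + of_nat (i\<^sup>2))
        (0 * (of_nat p - 2 * of_nat i) + of_nat (i\<^sup>2))"
      by (intro p_cong_add p_cong_mult rat_cong_p) simp_all
    moreover have "of_nat ((p - i)\<^sup>2) = of_nat p * (of_nat p - 2 * of_nat i) + (of_nat (i\<^sup>2) :: rat)"
      using assms(2) by (simp add: of_nat_diff power2_diff) (simp add: power2_eq_square algebra_simps)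
    ultimately show ?thesis by simp
  qed
  moreover have "\<not> p dvd (p - i)\<^sup>2" "\<not> p dvd i\<^sup>2"
    using not_dvd_small assms prime_dvd_power[OF prime_p] by (meson diff_less zero_less_diff order.strict_trans)+
  ultimately show ?thesis using rat_cong_inverse[of 1 "(p - i)\<^sup>2" "i\<^sup>2"] by simp
qed

lemma p_integral_inverse_square:
  assumes "0 < i" "i < p"
  shows "p_integral p (1 / of_nat i ^ 2)"
  using rat_cong_inverse_square_reflect[OF assms] p_cong_integral by blast

text \<open>
  With \<open>H\<close> the sum over \<open>i \<le> n\<close>, the sum over all \<open>i < p\<close> is \<open>2H\<close> by \<open>i \<mapsto> p - i\<close> and \<open>H/2\<close> by pairing
  \<open>2i\<close> with \<open>p - 2i\<close>, so \<open>3H \<equiv> 0\<close>.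
\<close>

lemma sum_inverse_squares: "rat_cong p 1 (\<Sum>i = 1..n. 1 / of_nat i ^ 2) 0"
proof -
  define g :: "nat \<Rightarrow> rat" where "g i = 1 / of_nat i ^ 2" for i
  define H where "H = (\<Sum>i = 1..n. g i)"
  have gi: "p_integral p (g i)" if "0 < i" "i < p" for i
    using p_integral_inverse_square that by (simp add: g_def)
  have refl: "rat_cong p 1 (g (2 * n + 1 - i)) (g i)" if "0 < i" "i < p" for i
    using rat_cong_inverse_square_reflect[OF that] by (simp only: g_def p_eq)
  have "rat_cong p 1 (\<Sum>k = 1..n. g k + g (2 * n + 1 - k)) (\<Sum>k = 1..n. g k + g k)"
  proof (rule rat_cong_sum[OF prime_p])
    fix k assume "k \<in> {1..n}"
    from half_range[OF this] show "rat_cong p 1 (g k + g (2 * n + 1 - k)) (g k + g k)"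
      by (intro p_cong_add refl) (simp_all add: gi)
  qed
  moreover have "(\<Sum>k = 1..n. g k + g k) = 2 * H"
    unfolding H_def sum.distrib by (rule mult_2[symmetric])
  ultimately have 1: "rat_cong p 1 (sum g {1..2 * n}) (2 * H)"
    unfolding sum.atLeastAtMost_double_fold by simp
  have "rat_cong p 1 (\<Sum>k = 1..n. g (2 * k) + g (2 * n + 1 - 2 * k)) (\<Sum>k = 1..n. g (2 * k) + g (2 * k))"
  proof (rule rat_cong_sum[OF prime_p])
    fix k assume "k \<in> {1..n}"
    from half_range[OF this]
    show "rat_cong p 1 (g (2 * k) + g (2 * n + 1 - 2 * k)) (g (2 * k) + g (2 * k))"
      by (intro p_cong_add refl) (simp_all add: gi)
  qed
  moreover have "(\<Sum>k = 1..n. g (2 * k) + g (2 * k)) = H / 2"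
    unfolding H_def sum_divide_distrib by (intro sum.cong) (auto simp: g_def field_simps)
  ultimately have 2: "rat_cong p 1 (sum g {1..2 * n}) (H / 2)"
    unfolding sum.atLeastAtMost_double_parity by (simp only:)
  \<comment> \<open>Doubling clears the half: 2(2H - H/2) = 3H, and 3 is invertible because p >
    3.\<close>
  have "rat_cong p 1 (2 * (sum g {1..2 * n} - sum g {1..2 * n})) (2 * (2 * H - H / 2))"
    using 1 2 by (intro p_cong_mult p_cong_diff) simp_all
  from rat_cong_sym[OF prime_p this] have "rat_cong p 1 (of_nat 3 * H) (of_nat 3 * 0)"
    by simp
  then have "rat_cong p 1 H 0"
    by (rule rat_cong_cancel[OF prime_p]) (use not_dvd_small p_gt_3 in auto)
  then show ?thesis by (simp add: H_def g_def)
qed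

section \<open>Morley's congruence\<close>

text \<open>Products of two or more correction terms carry p^4 and vanish modulo p^3.\<close>

lemma prod_one_plus_p_squared:
  assumes "finite A" "\<And>i. i \<in> A \<Longrightarrow> p_integral p (g i)"
  shows "rat_cong p 3 (\<Prod>i\<in>A. 1 + of_nat p ^ 2 * g i) (1 + of_nat p ^ 2 * sum g A)"
  using assms
proof (induction A rule: finite_induct)
  case empty
  then show ?case by simp
next
  case (insert x A)
  let ?s = "sum g A"
  have s: "p_integral p ?s" "p_integral p (g x)"
    using insert.prems by (auto intro: p_integral_sum[OF prime_p])
  have "rat_cong p 3 ((1 + of_nat p ^ 2 * g x) * (\<Prod>i\<in>A. 1 + of_nat p ^ 2 * g i))
      ((1 + of_nat p ^ 2 * g x) * (1 + of_nat p ^ 2 * ?s))"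
    by (intro p_cong_mult insert.IH) (use s insert.prems in auto)
  also have "rat_cong p 3 \<dots> (1 + of_nat p ^ 2 * (g x + ?s))"
    unfolding rat_cong_iff[OF prime_p]
    by (intro conjI exI[of _ "of_nat p * g x * ?s"])
       (use s in \<open>simp_all add: algebra_simps power2_eq_square power3_eq_cube\<close>)
  finally show ?case using insert.hyps by simp
qed

text \<open>
  Pairing the factors of \<open>(2n)!\<close> in two ways yields \<open>X = 4^n Y\<close> for \<open>X = \<Prod>(1 - p/i)\<close> and
  \<open>Y = \<Prod>(1 - p/(2i))\<close>. Since \<open>Y^2 = X Z\<close> with \<open>Z = \<Prod>(1 + p^2/(4i(i - p))) \<equiv> 1\<close> modulo \<open>p^3\<close>, this
  gives \<open>X = 16^n Z\<close>.
\<close>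

lemma morley: "rat_cong p 3 (of_nat ((2 * n) choose n) / 16 ^ n) ((- 1) ^ n)"
proof -
  define P :: rat where "P = of_nat p"
  define X where "X = (\<Prod>i = 1..n. 1 - P / of_nat i)"
  define Y where "Y = (\<Prod>i = 1..n. 1 - P / (2 * of_nat i))"
  \<comment> \<open>Chosen so that (1 - p/(2i))^2 = (1 - p/i)(1 + p^2 g(i)).\<close>
  define g where "g i = 1 / (4 * of_nat i * (of_nat i - P))" for i
  define Z where "Z = (\<Prod>i = 1..n. 1 + P ^ 2 * g i)"
  have nz: "of_nat i - P \<noteq> 0" "of_nat i \<noteq> (0 :: rat)" if "i \<in> {1..n}" for i
    using that p_eq by (auto simp: P_def)
  have P: "P = 1 + 2 * of_nat n"
    by (simp add: P_def p_eq)
  have bin: "of_nat ((2 * n) choose n) = (- 1) ^ n * X"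
  proof -
    have "fact (2 * n) = (\<Prod>i = 1..n. of_nat i * (P - of_nat i) :: rat)"
      unfolding fact_prod of_nat_prod prod.atLeastAtMost_double_fold
      by (intro prod.cong) (simp_all add: P of_nat_diff)
    moreover have "fact n = (\<Prod>i = 1..n. of_nat i :: rat)"
      by (simp add: fact_prod)
    ultimately have "of_nat ((2 * n) choose n)
        = (\<Prod>i = 1..n. of_nat i * (P - of_nat i) / (of_nat i * of_nat i))"
      by (simp add: binomial_fact prod.distrib prod_dividef)
    also have "\<dots> = (\<Prod>i = 1..n. - 1 * (1 - P / of_nat i))"
      using nz by (intro prod.cong) (simp_all add: field_simps)
    finally show ?thesis unfolding prod.distrib X_def by simp
  qed
  have XY: "X = 4 ^ n * Y"
  proof -
    have "(\<Prod>i = 1..n. of_nat i * (P - of_nat i)) = (\<Prod>i = 1..n. 2 * of_nat i * (P - 2 * of_nat i))"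
    proof -
      have "(\<Prod>i = 1..2 * n. of_nat i) = (\<Prod>i = 1..n. of_nat i * (P - of_nat i))"
        unfolding prod.atLeastAtMost_double_fold
        by (intro prod.cong) (simp_all add: P of_nat_diff)
      moreover have "(\<Prod>i = 1..2 * n. of_nat i) = (\<Prod>i = 1..n. 2 * of_nat i * (P - 2 * of_nat i))"
        unfolding prod.atLeastAtMost_double_parity
        by (intro prod.cong) (simp_all add: P of_nat_diff)
      ultimately show ?thesis by simp
    qed
    \<comment> \<open>Dividing by -i^2 turns the factors into 1 - p/i on the left and 4(1 - p/(2i))
      on the right.\<close>
    then have "(\<Prod>i = 1..n. of_nat i * (P - of_nat i)) / (\<Prod>i = 1..n. - of_nat i * of_nat i)
        = (\<Prod>i = 1..n. 2 * of_nat i * (P - 2 * of_nat i)) / (\<Prod>i = 1..n. - of_nat i * of_nat i)"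
      by simp
    then have "(\<Prod>i = 1..n. of_nat i * (P - of_nat i) / (- of_nat i * of_nat i))
        = (\<Prod>i = 1..n. 2 * of_nat i * (P - 2 * of_nat i) / (- of_nat i * of_nat i))"
      by (simp only: prod_dividef)
    moreover have "(\<Prod>i = 1..n. of_nat i * (P - of_nat i) / (- of_nat i * of_nat i)) = X"
      unfolding X_def using nz by (intro prod.cong) (simp_all add: field_simps)
    moreover have "(\<Prod>i = 1..n. 2 * of_nat i * (P - 2 * of_nat i) / (- of_nat i * of_nat i))
        = (\<Prod>i = 1..n. 4 * (1 - P / (2 * of_nat i)))"
      using nz by (intro prod.cong) (simp_all add: field_simps)
    ultimately show ?thesis unfolding prod.distrib Y_def by simp
  qed
  have "Y ^ 2 = X * Z"
    unfolding X_def Y_def Z_def power2_eq_square prod.distrib[symmetric]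
  proof (intro prod.cong refl)
    fix i assume "i \<in> {1..n}"
    from nz[OF this] show "(1 - P / (2 * of_nat i)) * (1 - P / (2 * of_nat i)) = (1 - P / of_nat i) * (1 + P * P * g i)"
      unfolding g_def by (simp add: divide_simps) (simp add: algebra_simps)
  qed
  moreover have "X \<noteq> 0" using bin by (auto simp: binomial_eq_0_iff)
  moreover have "X ^ 2 = 16 ^ n * Y ^ 2"
    unfolding XY by (simp add: power_mult_distrib power_mult[symmetric] mult.commute[of n] power_mult)
  ultimately have XZ: "X = 16 ^ n * Z"
    by (simp add: power2_eq_square)
  have gi: "rat_cong p 1 (g i) (1 / of_nat 4 * (1 / of_nat i ^ 2))" if i: "i \<in> {1..n}" for i
  proof -
    have nd: "\<not> p dvd 4 * i * i * (p - i)"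
      using not_dvd_small[of i] not_dvd_small[of "p - i"] half_range[OF i] not_dvd_4
      by (auto simp: prime_dvd_mult_iff[OF prime_p])
    have "of_nat (p - i) = P - of_nat i"
      using half_range[OF i] by (simp add: P_def of_nat_diff)
    \<comment> \<open>Replacing i - p by i in the denominator costs only a multiple of p, so the sum
      of g reduces to the sum of inverse squares.\<close>
    then have "g i = 1 / of_nat 4 * (1 / of_nat i ^ 2) + P * - inverse (of_nat (4 * i * i * (p - i)))"
      using nz[OF i] by (simp add: g_def divide_simps power2_eq_square)
    moreover have "p_integral p (1 / of_nat 4 * (1 / of_nat i ^ 2))"
      using half_range[OF i] not_dvd_4
      by (intro p_integral_mult[OF prime_p] p_integral_inverse_square p_integral_divide[OF prime_p]) auto
    ultimately show ?thesis
      unfolding rat_cong_iff[OF prime_p] P_def using nd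
      by (intro conjI exI[of _ "- inverse (of_nat (4 * i * i * (p - i)))"]) (simp_all only: integral_simps power_one_right simp_thms)
  qed
  have "rat_cong p 1 (sum g {1..n}) (\<Sum>i = 1..n. 1 / of_nat 4 * (1 / of_nat i ^ 2))"
    by (intro rat_cong_sum[OF prime_p] gi)
  also have "(\<Sum>i = 1..n. 1 / of_nat 4 * (1 / of_nat i ^ 2)) = 1 / of_nat 4 * (\<Sum>i = 1..n. 1 / of_nat i ^ 2 :: rat)"
    by (simp only: sum_distrib_left)
  also have "rat_cong p 1 \<dots> (1 / of_nat 4 * 0)"
    by (intro p_cong_mult sum_inverse_squares) (use p_integral_divide[OF prime_p, of 1 4] not_dvd_4 in simp)
  finally have "rat_cong p (2 + 1) (of_nat p ^ 2 * sum g {1..n}) (of_nat p ^ 2 * 0)"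
    by (intro rat_cong_scale[OF prime_p]) simp
  then have "rat_cong p 3 (1 + of_nat p ^ 2 * sum g {1..n}) (1 + 0)"
    by (intro p_cong_add) simp_all
  moreover have "rat_cong p 3 Z (1 + of_nat p ^ 2 * sum g {1..n})"
    unfolding Z_def P_def using gi p_cong_integral by (intro prod_one_plus_p_squared) auto
  ultimately have "rat_cong p 3 Z 1" using p_cong_trans by fastforce
  then have "rat_cong p 3 ((- 1) ^ n * Z) ((- 1) ^ n * 1)"
    by (intro p_cong_mult) simp_all
  then show ?thesis unfolding bin XZ by simp
qed

section \<open>The quotients at k = n and k = n + 1\<close>

lemma rat_cong_power_4: "rat_cong p 1 (1 / 4 ^ n) 1"
proof -
  have "\<not> p dvd 2" using not_dvd_small p_gt_3 by simp
  from rat_cong_fermat[OF prime_p this] have "rat_cong p 1 (of_nat (4 ^ n)) (of_nat 1)"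
    by (simp add: p_eq power_mult)
  moreover have "\<not> p dvd 4 ^ n" using not_dvd_4 prime_dvd_power[OF prime_p] by blast
  moreover have "\<not> p dvd 1" using not_dvd_small p_gt_3 by simp
  ultimately show ?thesis using rat_cong_inverse[of 1 "4 ^ n" 1] by simp
qed

text \<open>Row 2n is row p - 1, and 4^n = 2^(p-1) is 1 modulo p.\<close>

lemma rat_cong_offset_quot: "d \<le> n \<Longrightarrow> rat_cong p 1 (offset_quot n d) ((- 1) ^ (n + d))"
  using p_cong_mult[OF rat_cong_choose_prime_minus_1[OF prime_p, of "n + d"] rat_cong_power_4]
  by (simp add: offset_quot_def p_eq)

lemma rat_cong_central_quot: "rat_cong p 1 (central_quot n) ((- 1) ^ n)"
  using rat_cong_offset_quot[of 0] by simp

text \<open>At k = n the factor 2k + 1 equals p; the analogue for \<open>offset_quot\<close> yields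
  the second factor p of the boundary terms.\<close>

lemma central_quot_Suc_half: "(of_nat p + 1) * central_quot (Suc n) = of_nat p * central_quot n"
  using central_quot_Suc[of n] by (simp add: p_eq algebra_simps)

lemma offset_quot_Suc_half:
  "((of_nat p + 1)\<^sup>2 - 4 * (of_nat d)\<^sup>2) * offset_quot (Suc n) d = of_nat p * (of_nat p + 1) * offset_quot n d"
  using offset_quot_Suc_left_closed[of n d] by (simp add: p_eq power2_eq_square algebra_simps)

lemma boundary_term:
  assumes "Suc d < n"
  shows "rat_cong p 3 (central_quot (Suc n) * offset_quot (Suc n) (Suc d))
    (of_nat p ^ 2 * ((- 1) ^ d / of_nat ((2 * d + 1) * (2 * d + 3))))"
proof -
  \<comment> \<open>\<open>?q\<close> is (p + 1)^2 - 4(d + 1)^2 in factored form, which shows that p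
    does not divide it; modulo p it equals \<open>- ?r\<close>.\<close>
  let ?q = "(2 * n - 2 * d) * (2 * n + 2 * d + 4)" and ?r = "(2 * d + 1) * (2 * d + 3)"
  have nd: "\<not> p dvd ?q" "\<not> p dvd ?r"
  proof -
    have "\<not> p dvd 2 * n + 2 * d + 4"
    proof
      assume "p dvd 2 * n + 2 * d + 4"
      also have "2 * n + 2 * d + 4 = p + (2 * d + 3)" by (simp add: p_eq)
      finally have "p dvd 2 * d + 3" by simp
      then show False using not_dvd_small[of "2 * d + 3"] assms p_eq by simp
    qed
    moreover have "\<not> p dvd 2 * n - 2 * d" "\<not> p dvd 2 * d + 1" "\<not> p dvd 2 * d + 3"
      using assms p_eq by (intro not_dvd_small; simp)+
    ultimately show "\<not> p dvd ?q" "\<not> p dvd ?r"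
      by (simp_all only: prime_dvd_mult_iff[OF prime_p] simp_thms)
  qed
  have nz: "(of_nat ?q :: rat) \<noteq> 0" "(of_nat ?r :: rat) \<noteq> 0"
    using nd by (metis dvd_0_right of_nat_eq_0_iff)+
  define P :: rat where "P = of_nat p"
  have q: "of_nat ?q = (P + 1)\<^sup>2 - 4 * (of_nat (Suc d))\<^sup>2"
  proof -
    have "of_nat (2 * n - 2 * d) = (2 * of_nat n - 2 * of_nat d :: rat)"
      using assms by (simp add: of_nat_diff)
    then show ?thesis
      unfolding of_nat_mult by (simp add: P_def p_eq power2_eq_square algebra_simps)
  qed
  have nzP: "P + 1 \<noteq> 0" unfolding P_def by (metis of_nat_Suc add.commute of_nat_neq_0)
  have "(P + 1) * (of_nat ?q * (central_quot (Suc n) * offset_quot (Suc n) (Suc d)))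
      = ((P + 1) * central_quot (Suc n)) * (((P + 1)\<^sup>2 - 4 * (of_nat (Suc d))\<^sup>2) * offset_quot (Suc n) (Suc d))"
    unfolding q by (simp only: mult_ac)
  also have "\<dots> = (P + 1) * (P ^ 2 * (central_quot n * offset_quot n (Suc d)))"
    unfolding P_def central_quot_Suc_half offset_quot_Suc_half by (simp add: power2_eq_square mult_ac)
  finally have "of_nat ?q * (central_quot (Suc n) * offset_quot (Suc n) (Suc d)) = P ^ 2 * (central_quot n * offset_quot n (Suc d))"
    using nzP by simp
  then have "central_quot (Suc n) * offset_quot (Suc n) (Suc d) = P ^ 2 * (central_quot n * offset_quot n (Suc d)) / of_nat ?q"
    by (metis nonzero_mult_div_cancel_left nz(1))
  then have eq: "central_quot (Suc n) * offset_quot (Suc n) (Suc d) = P ^ 2 * (central_quot n * offset_quot n (Suc d) * (1 / of_nat ?q))"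
    by (simp only: times_divide_eq_right mult_1_right)
  have "rat_cong p 1 (P * (P + 2) + - of_nat ?r) (0 * (P + 2) + - of_nat ?r)"
    unfolding P_def by (intro p_cong_add p_cong_mult rat_cong_p) (simp_all del: of_nat_mult of_nat_add)
  moreover have "of_nat ?q = P * (P + 2) + - of_nat ?r"
    unfolding q by (simp add: power2_eq_square algebra_simps)
  ultimately have qr: "rat_cong p 1 (of_nat ?q) (- of_nat ?r)" by simp
  have "rat_cong p 1 (- of_nat ?r * (inverse (of_nat ?q) * inverse (of_nat ?r)))
      (of_nat ?q * (inverse (of_nat ?q) * inverse (of_nat ?r)))"
    by (rule p_cong_mult[OF rat_cong_sym[OF prime_p qr]])
       (use nd in \<open>simp del: of_nat_mult of_nat_add\<close>)
  then have "rat_cong p 1 (- (1 / of_nat ?q)) (1 / of_nat ?r)"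
    using nz by (simp add: field_simps del: of_nat_mult of_nat_add)
  then have "rat_cong p 1 (central_quot n * offset_quot n (Suc d) * (-1) * (- (1 / of_nat ?q)))
      ((- 1) ^ n * (- 1) ^ (n + Suc d) * (- 1) * (1 / of_nat ?r))"
    by (intro p_cong_mult rat_cong_central_quot rat_cong_offset_quot) (use assms in simp_all)
  moreover have "(- 1) ^ n * (- 1) ^ (n + Suc d) * (- 1) = ((- 1) ^ d :: rat)"
    by (simp add: power_add flip: power_mult_distrib mult.assoc)
  ultimately have "rat_cong p 1 (central_quot n * offset_quot n (Suc d) * (1 / of_nat ?q)) ((- 1) ^ d / of_nat ?r)"
    by simp
  from rat_cong_scale[OF prime_p this, of 2] show ?thesis
    unfolding eq P_def by simp
qed


section \<open>Differences of S_d modulo p^3\<close>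

lemma quot_sum_weighted_difference:
  "d < n \<Longrightarrow> rat_cong p 3 ((2 * of_nat d + 1) * (quot_sum (Suc n) (Suc d) - quot_sum (Suc n) d))
     (of_nat p ^ 2 * (- 2 * (- 1) ^ d / of_nat (2 * d + 1)))"
proof (induction d)
  case 0
  define P :: rat where "P = of_nat p"
  have nzP: "P + 1 \<noteq> 0" unfolding P_def by (metis of_nat_Suc add.commute of_nat_neq_0)
  have bP: "central_quot (Suc n) = P * central_quot n / (P + 1)"
    using central_quot_Suc_half nzP by (simp add: P_def field_simps)
  have n: "2 * of_nat (Suc n) = P + 1" by (simp add: P_def p_eq)
  have "quot_sum (Suc n) (Suc 0) - quot_sum (Suc n) 0 = - 4 * of_nat (Suc n) * central_quot (Suc n) ^ 2"
    using quot_sum_initial[of "Suc n"] by simp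
  also have "\<dots> = - 2 * (2 * of_nat (Suc n)) * central_quot (Suc n) ^ 2" by simp
  \<comment> \<open>One of the two factors p + 1 in the denominator cancels; the other is 1 modulo
    p.\<close>
  also have "\<dots> = - 2 * (P + 1) * (P * central_quot n / (P + 1)) ^ 2" by (simp only: n bP)
  also have "\<dots> = of_nat p ^ 2 * (- 2 * (central_quot n * central_quot n) * (1 / of_nat (p + 1)))"
    using nzP by (simp add: P_def power2_eq_square divide_simps) (simp add: algebra_simps)
  finally have eq: "quot_sum (Suc n) (Suc 0) - quot_sum (Suc n) 0 = of_nat p ^ 2 * (- 2 * (central_quot n * central_quot n) * (1 / of_nat (p + 1)))" .
  have nd: "\<not> p dvd 1" using not_dvd_small[of 1] p_gt_3 by simp
  then have "\<not> p dvd p + 1" by (simp only: dvd_add_triv_left_iff simp_thms)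
  moreover have "rat_cong p 1 (of_nat p + of_nat 1) (0 + of_nat 1)"
    by (intro p_cong_add rat_cong_p) simp
  ultimately have "rat_cong p 1 (1 / of_nat (p + 1)) (1 / of_nat 1)"
    using nd by (intro rat_cong_inverse) (simp_all add: add.commute)
  then have "rat_cong p 1 (- 2 * (central_quot n * central_quot n) * (1 / of_nat (p + 1))) (- 2 * ((- 1) ^ n * (- 1) ^ n) * (1 / of_nat 1))"
    by (intro p_cong_mult rat_cong_central_quot) simp_all
  also have "- 2 * ((- 1) ^ n * (- 1) ^ n) * (1 / of_nat 1) = (- 2 :: rat)"
    by (simp flip: power_mult_distrib)
  finally have "rat_cong p (2 + 1) (quot_sum (Suc n) (Suc 0) - quot_sum (Suc n) 0) (of_nat p ^ 2 * - 2)"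
    unfolding eq by (rule rat_cong_scale[OF prime_p])
  then show ?case by simp
next
  case (Suc d)
  let ?u = "of_nat d :: rat"
  have d: "Suc d < n" using Suc.prems .
  have eq: "(2 * ?u + 3) * (quot_sum (Suc n) (Suc (Suc d)) - quot_sum (Suc n) (Suc d))
      = (2 * ?u + 1) * (quot_sum (Suc n) (Suc d) - quot_sum (Suc n) d)
        + 8 * (?u + 1) * (central_quot (Suc n) * offset_quot (Suc n) (Suc d))"
    using quot_sum_recurrence[of d "Suc n"] by (simp add: algebra_simps numeral_2_eq_2)
  have "rat_cong p 3 ((2 * ?u + 3) * (quot_sum (Suc n) (Suc (Suc d)) - quot_sum (Suc n) (Suc d)))
     (of_nat p ^ 2 * (- 2 * (- 1) ^ d / of_nat (2 * d + 1))
       + 8 * (?u + 1) * (of_nat p ^ 2 * ((- 1) ^ d / of_nat ((2 * d + 1) * (2 * d + 3)))))"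
    unfolding eq by (intro p_cong_add p_cong_mult Suc.IH boundary_term d) (use d in simp_all)
  also have "of_nat p ^ 2 * (- 2 * (- 1) ^ d / of_nat (2 * d + 1))
       + 8 * (?u + 1) * (of_nat p ^ 2 * ((- 1) ^ d / of_nat ((2 * d + 1) * (2 * d + 3))))
     = of_nat p ^ 2 * (- 2 * (- 1) ^ Suc d / of_nat (2 * Suc d + 1))"
  proof -
    have nz: "(of_nat (2 * d + 1) :: rat) \<noteq> 0" "(of_nat (2 * d + 3) :: rat) \<noteq> 0"
      by (simp_all only: of_nat_eq_0_iff)
    \<comment> \<open>Since -2(2d + 3) + 8(d + 1) = 2(2d + 1), the old denominator cancels and the
      sign flips.\<close>
    have key: "- 2 * e / x + 8 * (?u + 1) * (e / (x * y)) = 2 * e / y"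
      if "x \<noteq> 0" "y \<noteq> 0" "x = 2 * ?u + 1" "y = 2 * ?u + 3" for e x y :: rat
    proof -
      have "- 2 * e / x + 8 * (?u + 1) * (e / (x * y)) = (- 2 * e * y + 8 * (?u + 1) * e) / (x * y)"
        using that(1,2) by (simp add: divide_simps)
      also have "- 2 * e * y + 8 * (?u + 1) * e = x * (2 * e)"
        unfolding that(3,4) by (simp add: algebra_simps)
      finally show ?thesis using that(1) by simp
    qed
    have "- 2 * (- 1) ^ d / of_nat (2 * d + 1) + 8 * (?u + 1) * ((- 1) ^ d / of_nat ((2 * d + 1) * (2 * d + 3)))
        = 2 * (- 1) ^ d / (of_nat (2 * d + 3) :: rat)"
      unfolding of_nat_mult[of "2 * d + 1" "2 * d + 3"] by (rule key[OF nz]) simp_all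
    then have "of_nat p ^ 2 * (- 2 * (- 1) ^ d / of_nat (2 * d + 1) + 8 * (?u + 1) * ((- 1) ^ d / of_nat ((2 * d + 1) * (2 * d + 3))))
        = of_nat p ^ 2 * (2 * (- 1) ^ d / (of_nat (2 * d + 3) :: rat))"
      by (simp only:)
    moreover have "2 * Suc d + 1 = 2 * d + 3" by simp
    moreover have "- 2 * (- 1) ^ Suc d = (2 * (- 1) ^ d :: rat)" by simp
    ultimately show ?thesis by (simp only: distrib_left mult.left_commute)
  qed
  finally show ?case by (simp add: algebra_simps)
qed

lemma quot_sum_difference:
  assumes "d < n"
  shows "rat_cong p 3 (quot_sum (Suc n) (Suc d) - quot_sum (Suc n) d) (of_nat p ^ 2 * (- 2 * (- 1) ^ d / of_nat (2 * d + 1) ^ 2))"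
proof -
  have nd: "\<not> p dvd 2 * d + 1" by (rule not_dvd_small) (use assms p_eq in simp_all)
  have nz: "(of_nat (2 * d + 1) :: rat) \<noteq> 0" by (simp only: of_nat_eq_0_iff)
  have "of_nat (2 * d + 1) * (of_nat p ^ 2 * (- 2 * (- 1) ^ d / of_nat (2 * d + 1) ^ 2))
      = of_nat p ^ 2 * (- 2 * (- 1) ^ d / (of_nat (2 * d + 1) :: rat))"
    using nz by (simp add: power2_eq_square del: of_nat_add of_nat_mult)
  then have "rat_cong p 3 (of_nat (2 * d + 1) * (quot_sum (Suc n) (Suc d) - quot_sum (Suc n) d))
      (of_nat (2 * d + 1) * (of_nat p ^ 2 * (- 2 * (- 1) ^ d / of_nat (2 * d + 1) ^ 2)))"
    using quot_sum_weighted_difference[OF assms] by (simp add: add.commute)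
  then show ?thesis by (rule rat_cong_cancel[OF prime_p _ nd])
qed

section \<open>Euler polynomials modulo p\<close>

text \<open>Induction along \<open>euler_poly_rec\<close>. The instance x = y also yields
  integrality of the values.\<close>

lemma rat_cong_euler_poly:
  assumes "rat_cong p 1 x y"
  shows "rat_cong p 1 (euler_poly m x) (euler_poly m y)"
proof (induction m rule: less_induct)
  case (less m)
  have "\<not> p dvd 2" using not_dvd_small p_gt_3 by simp
  then have "rat_cong p 1 (x ^ m - (\<Sum>i<m. of_nat (m choose i) * euler_poly i x) / of_nat 2)
      (y ^ m - (\<Sum>i<m. of_nat (m choose i) * euler_poly i y) / of_nat 2)"
    by (intro p_cong_diff rat_cong_power[OF prime_p] assms rat_cong_divide[OF prime_p]
        rat_cong_sum[OF prime_p] p_cong_mult less.IH) simp_all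
  then show ?case
    by (subst (1 2) euler_poly_rec) simp
qed

lemma half_odd_integral: "p_integral p (of_nat d + 1 / 2)"
proof -
  have "p_integral p (of_nat 1 / of_nat 2)"
    by (rule p_integral_divide[OF prime_p]) (use not_dvd_small[of 2] p_gt_3 in simp_all)
  then show ?thesis by simp
qed

lemma half_odd_power:
  assumes "d < n"
  shows "rat_cong p 1 ((of_nat d + 1 / 2) ^ (p - 3)) (4 / of_nat (2 * d + 1) ^ 2)"
proof -
  let ?u = "of_nat (2 * d + 1) :: rat"
  have nd: "\<not> p dvd 2 * d + 1" by (rule not_dvd_small) (use assms p_eq in simp_all)
  have nz: "?u \<noteq> 0" by (simp only: of_nat_eq_0_iff)
  have ui: "p_integral p (1 / ?u)"
    by (rule p_integral_divide[OF prime_p _ nd]) simp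
  have "p - 1 = (p - 3) + 2" using p_gt_3 by simp
  then have "?u ^ (p - 1) = ?u ^ (p - 3) * ?u ^ 2" "(2 :: rat) ^ (p - 1) = 2 ^ (p - 3) * 4"
    by (simp_all only: power_add power2_eq_square)
  moreover have "(2 :: rat) ^ (p - 1) = 4 ^ n" by (simp add: p_eq power_mult)
  \<comment> \<open>With u = 2d + 1, the power (u/2)^(p-3) is u^(p-1) / 2^(p-1) times 4/u^2, ready
    for Fermat's theorem.\<close>
  ultimately have "4 * ?u ^ (p - 1) * (1 / 4 ^ n) * (1 / ?u) ^ 2 = (?u / 2) ^ (p - 3)"
    using nz by (simp add: power_divide divide_simps)
  moreover have "?u / 2 = of_nat d + 1 / 2" by simp
  moreover have "rat_cong p 1 (4 * ?u ^ (p - 1) * (1 / 4 ^ n) * (1 / ?u) ^ 2) (4 * 1 * 1 * (1 / ?u) ^ 2)"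
    by (intro p_cong_mult rat_cong_fermat[OF prime_p nd] rat_cong_power_4)
       (simp_all only: integral_simps ui)
  moreover have "4 * 1 * 1 * (1 / ?u) ^ 2 = 4 / ?u ^ 2" by (simp add: power_divide)
  ultimately show ?thesis by (simp only:)
qed

section \<open>The second congruence\<close>

lemma quot_sum_top: "quot_sum (Suc n) n = of_nat ((2 * n) choose n) / 16 ^ n"
proof -
  have "(\<Sum>k<n. central_quot k * offset_quot k n) = 0"
    by (intro sum.neutral) (simp add: offset_quot_def)
  then have "quot_sum (Suc n) n = central_quot n * offset_quot n n"
    by (simp add: quot_sum_def)
  also have "\<dots> = of_nat ((2 * n) choose n) / (4 * 4) ^ n"
    unfolding power_mult_distrib by (simp add: central_quot_def offset_quot_def mult_2)
  finally show ?thesis by simp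
qed

text \<open>The induction runs downwards because the sum is explicitly known at d = n, where only
  its last term survives.\<close>

lemma quot_sum_cong:
  "d \<le> n \<Longrightarrow> rat_cong p 3 (quot_sum (Suc n) d)
     ((- 1) ^ n + of_nat p ^ 2 * ((- 1) ^ d / 4 * euler_poly (p - 3) (of_nat d + 1 / 2)))"
proof (induction d rule: inc_induct)
  case base
  have quarter: "p_integral p (1 / of_nat 4)"
    by (rule p_integral_divide[OF prime_p _ not_dvd_4]) simp
  have "rat_cong p 1 (of_nat p / of_nat 2) (0 / of_nat 2)"
    by (rule rat_cong_divide[OF prime_p rat_cong_p]) (use not_dvd_small p_gt_3 in simp)
  moreover have "of_nat p / of_nat 2 = (of_nat n + 1 / 2 :: rat)" by (simp add: p_eq)
  ultimately have "rat_cong p 1 (of_nat n + 1 / 2) 0" by (simp only: div_0)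
  then have "rat_cong p 1 (euler_poly (p - 3) (of_nat n + 1 / 2)) (euler_poly (p - 3) 0)"
    by (rule rat_cong_euler_poly)
  also have "euler_poly (p - 3) 0 = 0"
    \<comment> \<open>The index p - 3 = 2(n - 1) is even, and positive since p > 3.\<close>
    using p_gt_3 by (intro euler_poly_even_0) (simp_all add: p_eq)
  finally have "rat_cong p 1 ((- 1) ^ n * (1 / of_nat 4) * euler_poly (p - 3) (of_nat n + 1 / 2))
      ((- 1) ^ n * (1 / of_nat 4) * 0)"
    by (intro p_cong_mult) (simp_all only: integral_simps quarter)
  from rat_cong_scale[OF prime_p this, of 2]
  have "rat_cong p 3 ((- 1) ^ n + of_nat p ^ 2 * ((- 1) ^ n / 4 * euler_poly (p - 3) (of_nat n + 1 / 2))) ((- 1) ^ n + 0)"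
    by (intro p_cong_add) simp_all
  from rat_cong_sym[OF prime_p this] show ?case
    using morley unfolding quot_sum_top by (auto intro: p_cong_trans)
next
  case (step d)
  let ?E = "\<lambda>d. euler_poly (p - 3) (of_nat d + 1 / 2)"
  let ?u = "of_nat (2 * d + 1) :: rat"
  have quarter: "p_integral p (1 / of_nat 4)"
    by (rule p_integral_divide[OF prime_p _ not_dvd_4]) simp
  have E: "p_integral p (?E d)"
    using rat_cong_euler_poly[of "of_nat d + 1 / 2" "of_nat d + 1 / 2"] half_odd_integral by simp
  have "of_nat (Suc d) + 1 / 2 = of_nat d + 1 / 2 + (1 :: rat)" by simp
  then have Eeq: "?E (Suc d) = 2 * (of_nat d + 1 / 2) ^ (p - 3) - ?E d"
    using euler_poly_plus_1[of "p - 3" "of_nat d + 1 / 2"] by simp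
  have "rat_cong p 1 (?E (Suc d)) (2 * (4 / ?u ^ 2) - ?E d)"
    unfolding Eeq by (intro p_cong_diff p_cong_mult half_odd_power step.hyps)
       (simp_all only: integral_simps E)
  then have "rat_cong p 1 ((- 1) ^ Suc d * (1 / of_nat 4) * ?E (Suc d))
      ((- 1) ^ Suc d * (1 / of_nat 4) * (2 * (4 / ?u ^ 2) - ?E d))"
    by (intro p_cong_mult) (simp_all only: integral_simps quarter)
  \<comment> \<open>The extra summand is, up to the factor p^2, the difference S_(d+1) -
    S_d.\<close>
  also have "(- 1) ^ Suc d * (1 / of_nat 4) * (2 * (4 / ?u ^ 2) - ?E d)
      = (- 1) ^ d / 4 * ?E d + (- 2 * (- 1) ^ d / ?u ^ 2)"
    by (simp add: right_diff_distrib del: of_nat_add of_nat_mult)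
  finally have "rat_cong p 3 (of_nat p ^ 2 * ((- 1) ^ Suc d / 4 * ?E (Suc d)))
      (of_nat p ^ 2 * ((- 1) ^ d / 4 * ?E d + (- 2 * (- 1) ^ d / ?u ^ 2)))"
    using rat_cong_scale[OF prime_p, of 1 _ _ 2] by fastforce
  then have "rat_cong p 3 ((- 1) ^ n + of_nat p ^ 2 * ((- 1) ^ Suc d / 4 * ?E (Suc d)))
      ((- 1) ^ n + of_nat p ^ 2 * ((- 1) ^ d / 4 * ?E d + (- 2 * (- 1) ^ d / ?u ^ 2)))"
    by (intro p_cong_add) simp_all
  from p_cong_trans[OF step.IH this]
  have "rat_cong p 3 (quot_sum (Suc n) (Suc d) - (quot_sum (Suc n) (Suc d) - quot_sum (Suc n) d))
      ((- 1) ^ n + of_nat p ^ 2 * ((- 1) ^ d / 4 * ?E d + (- 2 * (- 1) ^ d / ?u ^ 2))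
        - of_nat p ^ 2 * (- 2 * (- 1) ^ d / ?u ^ 2))"
    by (intro p_cong_diff quot_sum_difference step.hyps)
  then show ?case by (simp only: distrib_left) simp
qed

section \<open>The first congruence\<close>

text \<open>The prime divides (2m)! since 2m \<ge> p, but not m!.\<close>

lemma central_quot_cong_0:
  assumes "n < m" "m < p"
  shows "rat_cong p 1 (central_quot m) 0"
proof -
  have "fact m * fact (2 * m - m) * ((2 * m) choose m) = (fact (2 * m) :: nat)"
    by (rule binomial_fact_lemma) simp
  moreover have "p dvd fact (2 * m)"
    unfolding prime_dvd_fact_iff[OF prime_p] using assms p_eq by simp
  ultimately have "p dvd fact m * fact m * ((2 * m) choose m)"
    by (simp add: mult_2)
  then have "p dvd (2 * m) choose m"
    using assms by (simp add: prime_dvd_mult_iff[OF prime_p] prime_dvd_fact_iff[OF prime_p])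
  then have "rat_cong p 1 (of_nat ((2 * m) choose m)) 0"
    by (rule rat_cong_0_of_nat[OF prime_p])
  moreover have "\<not> p dvd 4 ^ m" using not_dvd_4 prime_dvd_power[OF prime_p] by blast
  ultimately have "rat_cong p 1 (of_nat ((2 * m) choose m) / of_nat (4 ^ m)) (0 / of_nat (4 ^ m))"
    by (rule rat_cong_divide[OF prime_p])
  then show ?thesis by (simp add: central_quot_def)
qed

text \<open>For d = 0 this is S_0. In each step the boundary term is -p b_n b_(n+1+d), whose last
  factor supplies another p because n < n + 1 + d < p.\<close>

lemma sum_central_quot_cong:
  "d \<le> n \<Longrightarrow> rat_cong p 2 (\<Sum>k<Suc n. central_quot k * central_quot (k + d)) ((- 1) ^ n)"
proof (induction d)
  case 0
  let ?e = "1 / 4 * euler_poly (p - 3) (1 / 2)"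
  have "p_integral p (1 / of_nat 4)"
    by (rule p_integral_divide[OF prime_p _ not_dvd_4]) simp
  moreover have "p_integral p (euler_poly (p - 3) (1 / 2))"
    using rat_cong_euler_poly[of "1 / 2" "1 / 2"] half_odd_integral[of 0] by simp
  ultimately have "p_integral p (1 / of_nat 4 * euler_poly (p - 3) (1 / 2))"
    by (rule p_integral_mult[OF prime_p])
  then have e: "p_integral p ?e" by simp
  have "rat_cong p 2 (quot_sum (Suc n) 0) ((- 1) ^ n + of_nat p ^ 2 * ?e)"
    using rat_cong_mono[OF prime_p quot_sum_cong[of 0], of 2] by simp
  also have "rat_cong p 2 \<dots> ((- 1) ^ n)"
    unfolding rat_cong_iff[OF prime_p] by (intro conjI exI[of _ ?e] e) simp_all
  finally show ?case by (simp add: quot_sum_def)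
next
  case (Suc d)
  let ?W = "\<lambda>d. \<Sum>k<Suc n. central_quot k * central_quot (k + d)"
  have nd: "\<not> p dvd 2 * d + 1" by (rule not_dvd_small) (use Suc.prems p_eq in simp_all)
  have "(2 * of_nat d + 1) * (?W (Suc d) - ?W d) = - 2 * of_nat (Suc n) * central_quot (Suc n) * central_quot (Suc n + d)"
    by (rule sum_central_quot_recurrence)
  also have "\<dots> = - ((of_nat p + 1) * central_quot (Suc n)) * central_quot (Suc n + d)"
    by (simp add: p_eq algebra_simps)
  also have "\<dots> = of_nat p ^ 1 * (- central_quot n * central_quot (Suc n + d))"
    unfolding central_quot_Suc_half by simp
  finally have "of_nat (2 * d + 1) * (?W (Suc d) - ?W d) = of_nat p ^ 1 * (- central_quot n * central_quot (Suc n + d))"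
    by (simp only: of_nat_add of_nat_mult of_nat_numeral of_nat_1)
  moreover have "rat_cong p 1 (- central_quot n * central_quot (Suc n + d)) (- central_quot n * 0)"
  proof (rule p_cong_mult)
    show "rat_cong p 1 (- central_quot n) (- central_quot n)" using p_cong_integral(1)[OF rat_cong_central_quot] by simp
    show "rat_cong p 1 (central_quot (Suc n + d)) 0" using Suc.prems by (intro central_quot_cong_0) (simp_all add: p_eq)
  qed
  from rat_cong_scale[OF prime_p this, of 1]
  have "rat_cong p 2 (of_nat p ^ 1 * (- central_quot n * central_quot (Suc n + d))) (of_nat (2 * d + 1) * 0)"
    by (simp add: numeral_2_eq_2)
  ultimately have "rat_cong p 2 (of_nat (2 * d + 1) * (?W (Suc d) - ?W d)) (of_nat (2 * d + 1) * 0)"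
    by (simp only:)
  then have "rat_cong p 2 (?W (Suc d) - ?W d) 0"
    by (rule rat_cong_cancel[OF prime_p _ nd])
  moreover have "rat_cong p 2 (?W d) ((- 1) ^ n)" using Suc by simp
  ultimately have "rat_cong p 2 (?W (Suc d) - ?W d + ?W d) (0 + (- 1) ^ n)"
    by (rule p_cong_add)
  then show ?case by (simp only: diff_add_cancel add_0)
qed

section \<open>The Legendre symbol and the conclusion\<close>

text \<open>Euler's criterion gives this modulo p, and the two values differ by at most 2 <
  p.\<close>

lemma Legendre_minus_1: "Legendre (- 1) (int p) = (- 1) ^ n"
proof -
  have "[Legendre (- 1) (int p) = (- 1) ^ ((p - 1) div 2)] (mod int p)"
    by (rule euler_criterion[OF prime_p]) (use p_gt_3 in simp)
  then have "int p dvd Legendre (- 1) (int p) - (- 1) ^ n"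
    by (simp add: cong_iff_dvd_diff p_eq)
  moreover have "\<bar>Legendre (- 1) (int p) - (- 1) ^ n\<bar> \<le> 2"
    by (cases "even n") (auto simp: Legendre_def)
  ultimately have "Legendre (- 1) (int p) - (- 1) ^ n = 0"
    using dvd_imp_le_int[of "Legendre (- 1) (int p) - (- 1) ^ n" "int p"] p_gt_3 by force
  then show ?thesis by simp
qed

end

theorem theorem1p2:
  fixes p d :: nat
  assumes "prime p" and "p > 3" and "d \<in> {0..(p - 1) div 2}"
  shows "rat_cong p 2
           (\<Sum>k = 0..(p - 1) div 2.
              of_nat ((2 * k) choose k) * of_nat ((2 * k + 2 * d) choose (k + d)) / 16 ^ k)
           (4 ^ d * of_int (Legendre (-1) (int p)))
       \<and> rat_cong p 3
           (\<Sum>k = 0..(p - 1) div 2.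
              of_nat ((2 * k) choose k) * of_nat ((2 * k) choose (k + d)) / 16 ^ k)
           (of_int (Legendre (-1) (int p))
              + of_nat p ^ 2 * ((-1) ^ d / 4) * euler_poly (p - 3) (of_nat d + 1 / 2))"
proof -
  define n where "n = (p - 1) div 2"
  have "odd p" using assms(1,2) prime_odd_nat by simp
  then have p: "p = 2 * n + 1" unfolding n_def by (auto elim!: oddE)
  have d: "d \<le> n" using assms(3) by (simp add: n_def)
  have range: "{0..(p - 1) div 2} = {..<Suc n}" by (auto simp: n_def)
  have sixteen: "(16 :: rat) ^ k = 4 ^ k * 4 ^ k" for k
    by (simp flip: power_mult_distrib)
  have leg: "of_int (Legendre (- 1) (int p)) = ((- 1) ^ n :: rat)"
    by (simp add: Legendre_minus_1[OF assms(1,2) p])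
  \<comment> \<open>The second binomial coefficient is 4^(k+d) b_(k+d), whence the factor
    4^d.\<close>
  have "(\<Sum>k = 0..(p - 1) div 2.
      of_nat ((2 * k) choose k) * of_nat ((2 * k + 2 * d) choose (k + d)) / 16 ^ k)
     = 4 ^ d * (\<Sum>k<Suc n. central_quot k * central_quot (k + d))"
    unfolding range sum_distrib_left
    by (intro sum.cong) (simp_all add: central_quot_def sixteen power_add distrib_left)
  moreover have "rat_cong p 2 (4 ^ d * (\<Sum>k<Suc n. central_quot k * central_quot (k + d))) (4 ^ d * (- 1) ^ n)"
    using sum_central_quot_cong[OF assms(1,2) p d] assms(1)
    by (intro rat_cong_mult) (simp_all add: rat_cong_refl)
  moreover have "(\<Sum>k = 0..(p - 1) div 2.
      of_nat ((2 * k) choose k) * of_nat ((2 * k) choose (k + d)) / 16 ^ k) = quot_sum (Suc n) d"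
    unfolding range quot_sum_def by (intro sum.cong) (simp_all add: central_quot_def offset_quot_def sixteen)
  moreover note quot_sum_cong[OF assms(1,2) p d]
  ultimately show ?thesis unfolding leg by (simp only: mult.assoc simp_thms)
qed

end
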